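(* Let $f(x)=a_nx^n+\dots+a_0$ be a polynomial of degree $n\ge1$ with integer coefficients that is expansive, and let $\alpha$ be any root of $f$. Then \[ \frac{1}{|\alpha|-1}\le\begin{cases}2^{n-1}|a_0| & \text{if }\alpha\in\mathbb{R},\\ 2^{\binom{n}{2}}|a_0|^{n-1}+1 & \text{if }\alpha\in\mathbb{C}\setminus\mathbb{R}.\end{cases}\]
   Context: A polynomial is expansive if all of its complex roots $\alpha$ satisfy $|\alpha|>1$. *)

theory Defs
  imports Complex_Main "HOL-Computational_Algebra.Polynomial"
begin

definition expansive :: "complex poly \<Rightarrow> bool" where
  "expansive p \<longleftrightarrow> (\<forall>\<alpha>. poly p \<alpha> = 0 \<longrightarrow> 1 < cmod \<alpha>)"

end

theory Submission
  imports Defs "Jordan_Normal_Form.Determinant" "HOL-Computational_Algebra.Fundamental_Theorem_Algebra"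
begin

text \<open>
  Let \<open>\<alpha>\<^sub>1, \<dots>, \<alpha>\<^sub>n\<close> be the roots and \<open>a\<close> the leading coefficient. If \<open>\<alpha>\<close> is real with sign \<open>s\<close>,
  then \<open>f(s) = a \<Prod>\<^sub>i (s - \<alpha>\<^sub>i)\<close> is a nonzero integer one of whose factors has modulus \<open>|\<alpha>| - 1\<close>,
  while the others are bounded by \<open>2|\<alpha>\<^sub>i|\<close>. If \<open>\<alpha>\<close> is not real, the same argument applies to
  \<open>a\<^bsup>n-1\<^esup> \<Prod>\<^bsub>i<j\<^esub> (1 - \<alpha>\<^sub>i \<alpha>\<^sub>j)\<close>, where the pair of \<open>\<alpha>\<close> and its conjugate contributes \<open>|\<alpha>|\<^sup>2 - 1\<close>.
  This number is an integer since, up to sign, it is the determinant of Jury's matrix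
  \<open>jury_mat (n - 1) f\<close>. For distinct roots that follows by evaluating the rows of the matrix,
  read as antisymmetric Laurent polynomials, at \<open>n - 1\<close> of the roots; the general case follows by
  perturbing the roots.
\<close>

section \<open>Determinants of evaluated monic polynomials\<close>

text \<open>Passing from the monomials to another monic basis multiplies the matrix by a
  unitriangular coefficient matrix, which has determinant 1.\<close>

lemma det_monic_eval_eq_det_powers:
  fixes x :: "nat \<Rightarrow> 'a :: comm_ring_1" and p :: "nat \<Rightarrow> 'a poly"
  assumes deg: "\<And>j. j < m \<Longrightarrow> degree (p j) = j"
    and monic: "\<And>j. j < m \<Longrightarrow> coeff (p j) j = 1"
  shows "det (mat m m (\<lambda>(j, k). poly (p j) (x k))) = det (mat m m (\<lambda>(j, k). x k ^ j))"
proof -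
  define C where "C = mat m m (\<lambda>(j, i). coeff (p j) i)"
  define V where "V = mat m m (\<lambda>(j, k). x k ^ j)"
  have car: "C \<in> carrier_mat m m" "V \<in> carrier_mat m m"
    by (auto simp: C_def V_def)
  have "mat m m (\<lambda>(j, k). poly (p j) (x k)) = C * V"
  proof (rule eq_matI)
    fix j k assume "j < dim_row (C * V)" "k < dim_col (C * V)"
    then have jk: "j < m" "k < m" by (auto simp: C_def V_def)
    have "poly (p j) (x k) = (\<Sum>i\<le>j. coeff (p j) i * x k ^ i)"
      using deg[OF jk(1)] by (simp add: poly_altdef)
    also have "\<dots> = (\<Sum>i = 0..<m. coeff (p j) i * x k ^ i)"
      by (rule sum.mono_neutral_left) (use jk deg in \<open>auto simp: coeff_eq_0\<close>)
    finally show "mat m m (\<lambda>(j, k). poly (p j) (x k)) $$ (j, k) = (C * V) $$ (j, k)"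
      using jk by (simp add: C_def V_def scalar_prod_def)
  qed (auto simp: C_def V_def)
  moreover have "det C = 1"
  proof -
    have "det C = prod_list (diag_mat C)"
      by (rule det_lower_triangular[OF _ car(1)]) (auto simp: C_def deg coeff_eq_0)
    also have "\<dots> = 1"
      unfolding prod_list_diag_prod by (auto simp: C_def monic intro!: prod.neutral)
    finally show ?thesis .
  qed
  ultimately show ?thesis
    using det_mult[OF car] by (simp add: V_def)
qed

text \<open>In the Newton basis \<open>N j\<close> the matrix is triangular, since
  \<open>N j\<close> vanishes at \<open>x k\<close> for \<open>k < j\<close>; its diagonal gives the
  product.\<close>

lemma det_vandermonde:
  fixes x :: "nat \<Rightarrow> 'a :: idom"
  shows "det (mat m m (\<lambda>(j, k). x k ^ j)) = (\<Prod>k<m. \<Prod>l<k. x k - x l)"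
proof -
  define N where "N j = (\<Prod>l<j. [:- x l, 1:])" for j
  have deg: "degree (N j) = j" for j
    unfolding N_def by (subst degree_prod_sum_eq) auto
  have monic: "coeff (N j) j = 1" for j
  proof -
    have "lead_coeff (N j) = 1"
      by (simp add: N_def lead_coeff_prod)
    then show ?thesis by (simp add: deg)
  qed
  have ev: "poly (N j) y = (\<Prod>l<j. y - x l)" for j y
    by (simp add: N_def poly_prod)
  define A where "A = mat m m (\<lambda>(j, k). poly (N j) (x k))"
  have "det A = prod_list (diag_mat A)"
  proof (rule det_upper_triangular)
    show "A \<in> carrier_mat m m" by (simp add: A_def)
    show "upper_triangular A" by (auto simp: A_def ev upper_triangular_def)
  qed
  also have "\<dots> = (\<Prod>k<m. \<Prod>l<k. x k - x l)"
    unfolding prod_list_diag_prod by (auto simp: A_def ev atLeast0LessThan intro!: prod.cong)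
  finally show ?thesis
    using det_monic_eval_eq_det_powers[of m N x] deg monic by (simp add: A_def)
qed

section \<open>Chebyshev polynomials and antisymmetric powers\<close>

text \<open>Chebyshev polynomials of the second kind, rescaled to be monic.\<close>

fun cheb :: "nat \<Rightarrow> 'a :: idom poly" where
  "cheb 0 = 1"
| "cheb (Suc 0) = [:0, 1:]"
| "cheb (Suc (Suc r)) = [:0, 1:] * cheb (Suc r) - cheb r"

lemma cheb_monic: "degree (cheb r :: 'a :: idom poly) \<le> r \<and> coeff (cheb r :: 'a poly) r = 1"
proof (induction r rule: cheb.induct)
  case (3 r)
  have "degree ([:0, 1:] * cheb (Suc r) :: 'a poly) \<le> Suc (Suc r)"
    using 3 by (intro order.trans[OF degree_mult_le]) auto
  then show ?case
    using 3 by (auto intro!: degree_diff_le simp: coeff_eq_0)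
qed auto

lemma degree_cheb: "degree (cheb r :: 'a :: idom poly) = r"
  using cheb_monic[of r, where ?'a = 'a] by (metis le_antisym le_degree zero_neq_one)

text \<open>For x on the unit circle with angle t this is sin((r+1)t) = sin(t) U_r(cos t). Both
  sides obey the same three-term recurrence.\<close>

lemma cheb_eval:
  fixes x :: "'a :: field"
  assumes "x \<noteq> 0"
  shows "(x - inverse x) * poly (cheb r) (x + inverse x) = x ^ Suc r - inverse x ^ Suc r"
proof (induction r rule: cheb.induct)
  case (3 r)
  define y where "y = inverse x"
  have xy: "x * y = 1" using assms by (simp add: y_def)
  have "(x - y) * poly (cheb (Suc (Suc r))) (x + y) =
    (x + y) * ((x - y) * poly (cheb (Suc r)) (x + y)) - (x - y) * poly (cheb r) (x + y)"
    by (simp add: algebra_simps)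
  also have "\<dots> = (x + y) * (x ^ Suc (Suc r) - y ^ Suc (Suc r)) - (x ^ Suc r - y ^ Suc r)"
    using 3 by (simp only: y_def)
  \<comment> \<open>The mixed terms of the expansion carry a factor \<open>x * y = 1\<close>, so
    they cancel against the last bracket.\<close>
  also have "\<dots> = x ^ Suc (Suc (Suc r)) - y ^ Suc (Suc (Suc r))
      + (x * y) * (x ^ Suc r - y ^ Suc r) - (x ^ Suc r - y ^ Suc r)"
    by (simp add: algebra_simps)
  finally show ?case
    by (simp add: xy flip: y_def)
qed (auto simp: algebra_simps)

lemma det_scale_columns:
  fixes A :: "nat \<Rightarrow> nat \<Rightarrow> 'a :: idom"
  shows "det (mat m m (\<lambda>(j, k). A j k * d k)) = (\<Prod>k<m. d k) * det (mat m m (\<lambda>(j, k). A j k))"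
proof -
  define B where "B = mat m m (\<lambda>(j, k). A j k)"
  define D where "D = mat m m (\<lambda>(j, k). if j = k then d k else 0)"
  have car: "B \<in> carrier_mat m m" "D \<in> carrier_mat m m"
    by (auto simp: B_def D_def)
  have "mat m m (\<lambda>(j, k). A j k * d k) = B * D"
    by (rule eq_matI) (auto simp: B_def D_def scalar_prod_def if_distrib cong: if_cong)
  moreover have "det D = (\<Prod>k<m. d k)"
  proof -
    have "det D = prod_list (diag_mat D)"
      by (rule det_lower_triangular[OF _ car(2)]) (auto simp: D_def)
    then show ?thesis
      unfolding prod_list_diag_prod by (auto simp: D_def atLeast0LessThan)
  qed
  ultimately show ?thesis
    using det_mult[OF car] by (simp add: B_def mult.commute)
qed

text \<open>The Weyl denominator formula of type C. By \<open>cheb_eval\<close>, column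
  \<open>k\<close> is \<open>x k - inverse (x k)\<close> times a column of monic polynomials in
  \<open>x k + inverse (x k)\<close>, so a Vandermonde determinant remains.\<close>

lemma det_powers_minus_inverse_powers:
  fixes x :: "nat \<Rightarrow> 'a :: field"
  assumes "\<And>k. k < m \<Longrightarrow> x k \<noteq> 0"
  shows "det (mat m m (\<lambda>(r, k). x k ^ Suc r - inverse (x k) ^ Suc r)) =
    (\<Prod>k<m. x k - inverse (x k)) *
    (\<Prod>k<m. \<Prod>l<k. (x k + inverse (x k)) - (x l + inverse (x l)))"
proof -
  let ?u = "\<lambda>k. x k + inverse (x k)"
  have "mat m m (\<lambda>(r, k). x k ^ Suc r - inverse (x k) ^ Suc r) =
      mat m m (\<lambda>(r, k). poly (cheb r) (?u k) * (x k - inverse (x k)))"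
    using cheb_eval[OF assms] by (intro eq_matI) (auto simp: mult.commute)
  then show ?thesis
    using det_monic_eval_eq_det_powers[of m cheb ?u, OF degree_cheb conjunct2[OF cheb_monic]]
    by (simp add: det_scale_columns det_vandermonde[of m ?u])
qed

section \<open>Jury's determinant for distinct roots\<close>

text \<open>
  Row \<open>j\<close> lists the coefficients at \<open>x\<^sup>1, \<dots>, x\<^sup>m\<close> of the Laurent polynomial
  \<open>f(x) x\<^bsup>j-m\<^esup> - f(1/x) x\<^bsup>m-j\<^esup>\<close>, which is antisymmetric under \<open>x \<mapsto> 1/x\<close>.
\<close>

definition jury_mat :: "nat \<Rightarrow> 'a :: comm_ring_1 poly \<Rightarrow> 'a mat" where
  "jury_mat m f = mat m m (\<lambda>(j, r).
     coeff f (m - j + Suc r) - (if r < m - j then coeff f (m - j - Suc r) else 0))"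

text \<open>With \<open>d = m - j\<close>, the coefficient of index \<open>k\<close> contributes to
  the exponent \<open>k - d\<close>. Positive exponents give the first term of the matrix entry,
  negative ones are reflected and give the subtracted term, and \<open>k = d\<close>
  cancels.\<close>

lemma jury_mat_row:
  fixes f :: "'a :: field poly"
  assumes deg: "degree f \<le> Suc m" and j: "j < m" and x: "x \<noteq> 0"
  shows "(\<Sum>r<m. jury_mat m f $$ (j, r) * (x ^ Suc r - inverse x ^ Suc r)) =
    poly f x * inverse x ^ (m - j) - poly f (inverse x) * x ^ (m - j)"
proof -
  define y where "y = inverse x"
  have xy: "x * y = 1" using x by (simp add: y_def)
  define d where "d = m - j"
  have d: "0 < d" "d \<le> m" using j by (auto simp: d_def)
  let ?c = "coeff f"
  define S where "S r = x ^ r - y ^ r" for r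
  define g where "g k = ?c k * (x ^ k * y ^ d - y ^ k * x ^ d)" for k
  have split: "(\<Sum>k<d + e. g k) = (\<Sum>k<d. g k) + (\<Sum>k<e. g (d + k))" for e
    by (induction e) (auto simp: add.assoc)
  \<comment> \<open>Padding with zero coefficients to \<open>d + Suc m\<close> terms makes the
    exponents \<open>k - d\<close> run exactly from \<open>-d\<close> to \<open>m\<close>.\<close>
  have pf: "poly f z = (\<Sum>k<d + Suc m. ?c k * z ^ k)" for z
    unfolding poly_altdef
    by (rule sum.mono_neutral_left) (use deg d in \<open>auto simp: coeff_eq_0\<close>)
  have pow: "x ^ (i + e) * y ^ i = x ^ e" "y ^ (i + e) * x ^ i = y ^ e" for i e
  proof -
    have "x ^ (i + e) * y ^ i = (x * y) ^ i * x ^ e" "y ^ (i + e) * x ^ i = (x * y) ^ i * y ^ e"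
      unfolding power_mult_distrib power_add by (simp_all only: mult_ac)
    then show "x ^ (i + e) * y ^ i = x ^ e" "y ^ (i + e) * x ^ i = y ^ e"
      by (simp_all add: xy)
  qed
  have high: "g (d + r) = ?c (d + r) * S r" for r
    unfolding g_def S_def pow ..
  have low: "g (d - Suc r) = - (?c (d - Suc r) * S (Suc r))" if "r < d" for r
  proof -
    have "d = (d - Suc r) + Suc r" using that by simp
    then have "x ^ d * y ^ (d - Suc r) = x ^ Suc r" "y ^ d * x ^ (d - Suc r) = y ^ Suc r"
      using pow[of "d - Suc r" "Suc r"] by simp_all
    then show ?thesis
      unfolding g_def S_def by (simp add: mult.commute algebra_simps)
  qed
  have "poly f x * y ^ d - poly f y * x ^ d = (\<Sum>k<d + Suc m. g k)"
    unfolding pf sum_distrib_right sum_subtractf[symmetric] g_def by (simp add: algebra_simps)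
  also have "\<dots> = (\<Sum>r<d. g (d - Suc r)) + (\<Sum>r<m. g (d + Suc r))"
    unfolding split sum.nat_diff_reindex sum.lessThan_Suc_shift[of "\<lambda>k. g (d + k)"]
    using high[of 0] by (simp add: S_def)
  also have "(\<Sum>r<d. g (d - Suc r)) = (\<Sum>r<d. - (?c (d - Suc r) * S (Suc r)))"
    by (rule sum.cong) (auto simp: low)
  also have "\<dots> = (\<Sum>r<m. if r < d then - (?c (d - Suc r) * S (Suc r)) else 0)"
    by (rule sum.mono_neutral_cong_left) (use d in auto)
  also have "\<dots> + (\<Sum>r<m. g (d + Suc r)) = (\<Sum>r<m. jury_mat m f $$ (j, r) * S (Suc r))"
    unfolding sum.distrib[symmetric]
    unfolding high by (rule sum.cong) (use j in \<open>auto simp: jury_mat_def algebra_simps simp flip: d_def\<close>)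
  finally show ?thesis
    by (simp add: S_def y_def d_def)
qed

text \<open>The rectangle of indices consists of its diagonal, the part below it, and the part above
  it; by symmetry the last is transposed to the full triangle with \<open>k \<le> m\<close>.\<close>

lemma prod_square_triangle:
  fixes w :: "nat \<Rightarrow> nat \<Rightarrow> 'a :: comm_monoid_mult"
  assumes sym: "\<And>k l. w k l = w l k"
  shows "(\<Prod>k<m. \<Prod>l<Suc m. w k l) =
    (\<Prod>k<m. w k k) * (\<Prod>k<m. \<Prod>l<k. w k l) * (\<Prod>k<Suc m. \<Prod>l<k. w k l)"
proof (induction m)
  case (Suc m)
  have "(\<Prod>k<Suc m. \<Prod>l<Suc (Suc m). w k l) =
      (\<Prod>k<m. \<Prod>l<Suc m. w k l) * (\<Prod>k<m. w k (Suc m)) * (\<Prod>l<Suc (Suc m). w m l)"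
    by (simp add: prod.distrib mult_ac)
  also have "(\<Prod>k<m. w k (Suc m)) = (\<Prod>k<m. w (Suc m) k)"
    by (rule prod.cong) (auto intro: sym)
  finally show ?case
    unfolding Suc.IH using sym[of m "Suc m"] by (simp add: mult_ac)
qed simp

text \<open>The matrix is multiplied by \<open>E\<close>, which evaluates its rows at the first
  \<open>m\<close> roots. There \<open>f\<close> vanishes, so only the \<open>f(1/x)\<close> term of
  \<open>jury_mat_row\<close> survives and column \<open>k\<close> is \<open>d k\<close> times the
  powers of \<open>1 / x k\<close>: again a Vandermonde matrix. Taking moduli removes all
  signs.\<close>

lemma norm_det_jury_mat_distinct:
  fixes x :: "nat \<Rightarrow> complex"
  assumes big: "\<And>k. k \<le> m \<Longrightarrow> 1 < cmod (x k)"
    and dist: "inj_on x {..m}"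
    and f: "f = Polynomial.smult a (\<Prod>l<Suc m. [:- x l, 1:])"
  shows "cmod (det (jury_mat m f)) = cmod a ^ m * (\<Prod>k<Suc m. \<Prod>l<k. cmod (1 - x k * x l))"
proof -
  let ?y = "\<lambda>k. inverse (x k)"
  define w where "w k l = cmod (1 - x k * x l)" for k l
  have wsym: "w k l = w l k" for k l by (simp add: w_def mult.commute)
  have nz: "x k \<noteq> 0" if "k \<le> m" for k using big[OF that] by auto
  have wpos: "w k l > 0" if "k \<le> m" "l \<le> m" for k l
  proof -
    have "1 < cmod (x k) * cmod (x l)"
      using big[OF that(1)] big[OF that(2)] by (simp add: less_1_mult)
    then have "x k * x l \<noteq> 1"
      by (metis norm_mult norm_one less_irrefl)
    then show ?thesis by (simp add: w_def)
  qed
  have deg: "degree f \<le> Suc m"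
    unfolding f by (rule order.trans[OF degree_smult_le], subst degree_prod_sum_eq) auto
  have pf: "poly f z = a * (\<Prod>l<Suc m. z - x l)" for z
    unfolding f poly_smult poly_prod by simp
  define E where "E = mat m m (\<lambda>(r, k). x k ^ Suc r - ?y k ^ Suc r)"
  define d where "d k = - poly f (?y k) * x k ^ m" for k
  have car: "jury_mat m f \<in> carrier_mat m m" "E \<in> carrier_mat m m"
    by (auto simp: jury_mat_def E_def)
  have root: "poly f (x k) = 0" if "k \<le> m" for k
    using that by (auto simp: pf simp del: prod.lessThan_Suc)
  have "jury_mat m f * E = mat m m (\<lambda>(j, k). ?y k ^ j * d k)"
  proof (rule eq_matI)
    fix j k assume "j < dim_row (mat m m (\<lambda>(j, k). ?y k ^ j * d k))"
      and "k < dim_col (mat m m (\<lambda>(j, k). ?y k ^ j * d k))"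
    then have jk: "j < m" "k < m" by auto
    have "(jury_mat m f * E) $$ (j, k) =
        (\<Sum>r<m. jury_mat m f $$ (j, r) * (x k ^ Suc r - ?y k ^ Suc r))"
      using jk car by (simp add: scalar_prod_def E_def atLeast0LessThan)
    also have "\<dots> = poly f (x k) * ?y k ^ (m - j) - poly f (?y k) * x k ^ (m - j)"
      using jk deg nz by (intro jury_mat_row) auto
    also have "\<dots> = ?y k ^ j * d k"
      using jk nz[of k] root[of k] by (simp add: d_def power_diff field_simps)
    finally show "(jury_mat m f * E) $$ (j, k) = mat m m (\<lambda>(j, k). ?y k ^ j * d k) $$ (j, k)"
      using jk by simp
  qed (auto simp: jury_mat_def E_def)
  then have "det (jury_mat m f) * det E = (\<Prod>k<m. d k) * (\<Prod>k<m. \<Prod>l<k. ?y k - ?y l)"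
    using det_mult[OF car] by (simp add: det_scale_columns det_vandermonde)
  moreover have "det E = (\<Prod>k<m. x k - ?y k) * (\<Prod>k<m. \<Prod>l<k. (x k + ?y k) - (x l + ?y l))"
    unfolding E_def by (rule det_powers_minus_inverse_powers) (use nz in auto)
  ultimately have
    "cmod (det (jury_mat m f) * ((\<Prod>k<m. x k - ?y k) * (\<Prod>k<m. \<Prod>l<k. (x k + ?y k) - (x l + ?y l)))) =
     cmod ((\<Prod>k<m. d k) * (\<Prod>k<m. \<Prod>l<k. ?y k - ?y l))"
    by simp
  then have eq: "cmod (det (jury_mat m f)) *
      ((\<Prod>k<m. cmod (x k - ?y k)) * (\<Prod>k<m. \<Prod>l<k. cmod ((x k + ?y k) - (x l + ?y l)))) =
     (\<Prod>k<m. cmod (d k)) * (\<Prod>k<m. \<Prod>l<k. cmod (?y k - ?y l))"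
    unfolding norm_mult prod_norm[symmetric] .
  define V where "V = (\<Prod>k<m. \<Prod>l<k. cmod (?y k - ?y l))"
  define X where "X = (\<Prod>k<m. cmod (x k))"
  define W where "W = (\<Prod>k<m. w k k)"
  define Q where "Q = (\<Prod>k<m. \<Prod>l<k. w k l)"
  have "V \<noteq> 0"
    using dist by (auto simp: V_def dest!: inj_onD)
  have "X > 0" unfolding X_def using nz by (intro prod_pos) auto
  have "W > 0" "Q > 0" unfolding W_def Q_def using wpos by (auto intro!: prod_pos)
  have e1: "(\<Prod>k<m. cmod (x k - ?y k)) = W / X"
    unfolding W_def X_def prod_dividef[symmetric]
  proof (rule prod.cong)
    fix k assume "k \<in> {..<m}"
    then have "x k \<noteq> 0" using nz by auto
    then have "x k - ?y k = - (1 - x k * x k) / x k" by (simp add: field_simps)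
    then show "cmod (x k - ?y k) = w k k / cmod (x k)"
      by (simp add: w_def norm_divide norm_minus_commute)
  qed simp
  have e2: "(\<Prod>k<m. \<Prod>l<k. cmod ((x k + ?y k) - (x l + ?y l))) = V * Q"
    unfolding V_def Q_def prod.distrib[symmetric]
  proof (intro prod.cong refl)
    fix k l assume "k \<in> {..<m}" "l \<in> {..<k}"
    then have "x k \<noteq> 0" "x l \<noteq> 0" using nz by auto
    then have "(x k + ?y k) - (x l + ?y l) = (?y k - ?y l) * (1 - x k * x l)"
      by (simp add: field_simps)
    then show "cmod ((x k + ?y k) - (x l + ?y l)) = cmod (?y k - ?y l) * w k l"
      by (simp add: w_def norm_mult)
  qed
  \<comment> \<open>Each factor \<open>?y k - x l\<close> is \<open>(1 - x k * x l) / x k\<close>.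
    The \<open>m + 1\<close> denominators meet \<open>x k ^ m\<close>, leaving the same
    \<open>1 / X\<close> as in \<open>e1\<close>.\<close>
  have e3: "(\<Prod>k<m. cmod (d k)) = cmod a ^ m / X * (\<Prod>k<m. \<Prod>l<Suc m. w k l)"
  proof -
    have "cmod (d k) = cmod a / cmod (x k) * (\<Prod>l<Suc m. w k l)" if "k < m" for k
    proof -
      have k: "x k \<noteq> 0" using nz that by auto
      have "(\<Prod>l<Suc m. ?y k - x l) = (\<Prod>l<Suc m. (1 - x k * x l) / x k)"
        using k by (intro prod.cong) (auto simp: field_simps)
      also have "\<dots> = (\<Prod>l<Suc m. 1 - x k * x l) / x k ^ Suc m"
        by (simp only: prod_dividef prod_constant card_lessThan)
      finally have "cmod (d k) = cmod a * (cmod (\<Prod>l<Suc m. 1 - x k * x l) / cmod (x k) ^ Suc m) * cmod (x k) ^ m"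
        unfolding d_def pf by (simp only: norm_mult norm_minus_cancel norm_divide norm_power)
      also have "\<dots> = cmod a / cmod (x k) * (\<Prod>l<Suc m. w k l)"
        unfolding w_def prod_norm using k by (simp add: field_simps del: prod.lessThan_Suc)
      finally show ?thesis .
    qed
    then have "(\<Prod>k<m. cmod (d k)) = (\<Prod>k<m. cmod a / cmod (x k) * (\<Prod>l<Suc m. w k l))"
      by (intro prod.cong) auto
    then show ?thesis
      by (simp only: prod.distrib prod_dividef prod_constant card_lessThan X_def)
  qed
  \<comment> \<open>The rectangle in \<open>e3\<close> splits into \<open>W\<close>,
    \<open>Q\<close> and the desired triangle, so the nonzero factor \<open>W * Q * V / X\<close> is
    common to both sides. Distinctness of the roots enters through \<open>V\<close>.\<close>
  have "cmod (det (jury_mat m f)) * (W * Q * V / X) =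
      cmod a ^ m * (\<Prod>k<Suc m. \<Prod>l<k. w k l) * (W * Q * V / X)"
    using eq unfolding e1 e2 e3 V_def[symmetric] prod_square_triangle[of w m, OF wsym]
    by (simp add: W_def Q_def mult_ac del: prod.lessThan_Suc)
  then show ?thesis
    using \<open>V \<noteq> 0\<close> \<open>X > 0\<close> \<open>W > 0\<close> \<open>Q > 0\<close> by (simp add: w_def del: prod.lessThan_Suc)
qed

section \<open>Repeated roots by continuity\<close>

text \<open>By the Leibniz formula the determinant is a polynomial in the entries.\<close>

lemma tendsto_det:
  fixes A :: "'b \<Rightarrow> nat \<Rightarrow> nat \<Rightarrow> 'a :: {real_normed_algebra_1, comm_ring_1}"
  assumes "\<And>i j. i < m \<Longrightarrow> j < m \<Longrightarrow> ((\<lambda>t. A t i j) \<longlongrightarrow> B i j) F"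
  shows "((\<lambda>t. det (mat m m (\<lambda>(i, j). A t i j))) \<longlongrightarrow> det (mat m m (\<lambda>(i, j). B i j))) F"
proof -
  have "det (mat m m (\<lambda>(i, j). C i j)) =
      (\<Sum>p | p permutes {0..<m}. signof p * (\<Prod>i = 0..<m. C i (p i)))" for C :: "nat \<Rightarrow> nat \<Rightarrow> 'a"
    by (subst det_def'[of _ m])
      (auto intro!: sum.cong prod.cong arg_cong2[where f = "(*)"] dest: permutes_in_image)
  moreover have "p i < m" if "p permutes {0..<m}" "i < m" for p i
    using permutes_in_image[OF that(1), of i] that(2) by simp
  ultimately show ?thesis
    using assms by (auto intro!: tendsto_sum tendsto_mult tendsto_const tendsto_prod)
qed

lemma tendsto_coeff_prod_linear:
  fixes g :: "'b \<Rightarrow> nat \<Rightarrow> 'a :: {real_normed_algebra_1, comm_ring_1}"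
  assumes "\<And>l. ((\<lambda>t. g t l) \<longlongrightarrow> h l) F"
  shows "((\<lambda>t. coeff (\<Prod>l<N. [:- g t l, 1:]) k) \<longlongrightarrow> coeff (\<Prod>l<N. [:- h l, 1:]) k) F"
proof (induction N arbitrary: k)
  case (Suc N)
  show ?case
    by (cases k) (auto simp: mult_pCons_right intro!: tendsto_intros assms Suc)
qed auto

text \<open>Both sides depend continuously on the roots, and arbitrarily small perturbations make
  the roots distinct while keeping them outside the closed unit disc.\<close>

lemma norm_det_jury_mat:
  fixes x :: "nat \<Rightarrow> complex"
  assumes big: "\<And>k. k \<le> m \<Longrightarrow> 1 < cmod (x k)"
    and f: "f = Polynomial.smult a (\<Prod>l<Suc m. [:- x l, 1:])"
  shows "cmod (det (jury_mat m f)) = cmod a ^ m * (\<Prod>k<Suc m. \<Prod>l<k. cmod (1 - x k * x l))"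
proof -
  \<comment> \<open>The speeds \<open>of_nat l\<close> are pairwise different, so two perturbed
    roots meet for only one value of \<open>t\<close>. The punctured filter \<open>at 0\<close>
    excludes it even if it is 0.\<close>
  define g :: "complex \<Rightarrow> nat \<Rightarrow> complex" where "g t l = x l + t * of_nat l" for t l
  define P where "P t = Polynomial.smult a (\<Prod>l<Suc m. [:- g t l, 1:])" for t
  have g0: "((\<lambda>t. g t l) \<longlongrightarrow> x l) (at 0)" for l
    unfolding g_def by (rule tendsto_eq_intros refl | simp)+
  have "((\<lambda>t. coeff (P t) k) \<longlongrightarrow> coeff f k) (at 0)" for k
    unfolding P_def f coeff_smult by (intro tendsto_intros tendsto_coeff_prod_linear g0)
  then have "((\<lambda>t. det (jury_mat m (P t))) \<longlongrightarrow> det (jury_mat m f)) (at 0)"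
    unfolding jury_mat_def by (intro tendsto_det) (auto intro!: tendsto_intros)
  then have lim1: "((\<lambda>t. cmod (det (jury_mat m (P t)))) \<longlongrightarrow> cmod (det (jury_mat m f))) (at 0)"
    by (rule tendsto_norm)
  have lim2: "((\<lambda>t. cmod a ^ m * (\<Prod>k<Suc m. \<Prod>l<k. cmod (1 - g t k * g t l))) \<longlongrightarrow>
      cmod a ^ m * (\<Prod>k<Suc m. \<Prod>l<k. cmod (1 - x k * x l))) (at 0)"
    by (intro tendsto_intros g0)
  have "eventually (\<lambda>t. \<forall>k\<in>{..m}. 1 < cmod (g t k)) (at 0)"
    by (intro eventually_ball_finite ballI order_tendstoD(1)[OF tendsto_norm[OF g0]]) (auto intro: big)
  moreover have "eventually (\<lambda>t. \<forall>k\<in>{..m}. \<forall>l\<in>{..m}. k \<noteq> l \<longrightarrow> g t k \<noteq> g t l) (at 0)"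
  proof (intro eventually_ball_finite ballI)
    fix k l
    show "eventually (\<lambda>t. k \<noteq> l \<longrightarrow> g t k \<noteq> g t l) (at 0)"
    proof (cases "k = l")
      case False
      then have nz: "of_nat k - of_nat l \<noteq> (0 :: complex)" by simp
      have "eventually (\<lambda>t. t \<noteq> (x l - x k) / (of_nat k - of_nat l)) (at 0)"
        by (rule eventually_neq_at_within)
      then show ?thesis
        by eventually_elim (use nz in \<open>auto simp: g_def field_simps\<close>)
    qed simp
  qed auto
  ultimately have "eventually (\<lambda>t. cmod (det (jury_mat m (P t))) =
      cmod a ^ m * (\<Prod>k<Suc m. \<Prod>l<k. cmod (1 - g t k * g t l))) (at 0)"
    by eventually_elim (rule norm_det_jury_mat_distinct, auto simp: P_def inj_on_def)
  from tendsto_cong[THEN iffD1, OF this lim1] lim2 show ?thesis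
    using tendsto_unique[OF at_neq_bot] by blast
qed

section \<open>Estimates for products over the roots\<close>

text \<open>All factors but the small one at \<open>p\<close> are replaced by their bounds.
  Multiplying by \<open>g p\<close> instead of dividing also covers \<open>g p = 0\<close>.\<close>

lemma prod_mult_le_replace_factor:
  fixes w g :: "'b \<Rightarrow> real"
  assumes "finite A" "p \<in> A" and "\<And>i. i \<in> A \<Longrightarrow> 0 \<le> w i \<and> w i \<le> g i"
  shows "prod w A * g p \<le> w p * prod g A"
proof -
  have "prod w (A - {p}) \<le> prod g (A - {p})"
    using assms by (intro prod_mono) auto
  moreover have "0 \<le> w p * g p"
    using assms(2,3) by (meson mult_nonneg_nonneg order.trans)
  ultimately have "w p * g p * prod w (A - {p}) \<le> w p * g p * prod g (A - {p})"
    by (rule mult_left_mono)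
  then show ?thesis
    using assms by (simp add: prod.remove mult_ac)
qed

text \<open>Each index lies in \<open>n - 1\<close> pairs; the extra product on the left raises this
  exponent to \<open>n\<close> and avoids truncated subtraction.\<close>

lemma prod_pairs:
  fixes r :: "nat \<Rightarrow> 'a :: comm_semiring_1"
  shows "(\<Prod>k<n. \<Prod>l<k. c * r k * r l) * (\<Prod>k<n. r k) = c ^ (n choose 2) * (\<Prod>k<n. r k) ^ n"
proof (induction n)
  case (Suc n)
  have "(\<Prod>k<Suc n. \<Prod>l<k. c * r k * r l) * (\<Prod>k<Suc n. r k) =
      ((\<Prod>k<n. \<Prod>l<k. c * r k * r l) * (\<Prod>k<n. r k)) * (c ^ n * r n ^ n * (\<Prod>k<n. r k) * r n)"
    by (simp add: prod.distrib power_mult_distrib mult_ac)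
  also have "\<dots> = c ^ (n + (n choose 2)) * ((\<Prod>k<n. r k) ^ Suc n * r n ^ Suc n)"
    unfolding Suc.IH by (simp add: power_add mult_ac)
  also have "n + (n choose 2) = Suc n choose 2"
    by (simp add: numeral_2_eq_2)
  finally show ?case
    by (simp add: power_mult_distrib mult_ac)
qed (simp add: numeral_2_eq_2)

text \<open>The fundamental theorem of algebra with the roots enumerated with multiplicity, as
  products over pairs \<open>l < k\<close> require.\<close>

lemma complex_poly_split:
  fixes p :: "complex poly"
  assumes "p \<noteq> 0"
  obtains x where "p = Polynomial.smult (lead_coeff p) (\<Prod>l<degree p. [:- x l, 1:])"
proof -
  obtain A where A: "size A = degree p" "p = Polynomial.smult (lead_coeff p) (\<Prod>x\<in>#A. [:- x, 1:])"
    using alg_closed_imp_factorization[OF assms] by blast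
  obtain xs where xs: "mset xs = A"
    using ex_mset by blast
  have "(\<Prod>x\<in>#A. [:- x, 1:]) = (\<Prod>l<degree p. [:- (xs ! l), 1:])"
    using A(1) by (auto simp: prod_mset_prod_list prod.list_conv_set_nth atLeast0LessThan
        simp flip: xs mset_map)
  then show thesis
    using A(2) that[of "\<lambda>l. xs ! l"] by simp
qed

lemma expansive_real_root_bound:
  fixes x :: "nat \<Rightarrow> complex"
  assumes big: "\<And>k. k < n \<Longrightarrow> 1 < cmod (x k)"
    and i: "i < n" and s: "cmod s = 1" "cmod (s - x i) = cmod (x i) - 1"
    and ge: "1 \<le> cmod a * (\<Prod>k<n. cmod (s - x k))"
  shows "1 / (cmod (x i) - 1) \<le> 2 ^ (n - 1) * (cmod a * (\<Prod>k<n. cmod (x k)))"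
proof -
  define r where "r = cmod (x i)"
  have r: "r > 1" using big[OF i] by (simp add: r_def)
  have "(\<Prod>k<n. cmod (s - x k)) * (2 * r) \<le> cmod (s - x i) * (\<Prod>k<n. 2 * cmod (x k))"
    unfolding r_def
  proof (rule prod_mult_le_replace_factor)
    fix k assume "k \<in> {..<n}"
    then have "1 < cmod (x k)" using big by simp
    then show "0 \<le> cmod (s - x k) \<and> cmod (s - x k) \<le> 2 * cmod (x k)"
      using norm_triangle_ineq4[of s "x k"] s(1) by simp
  qed (use i in auto)
  then have "cmod a * ((\<Prod>k<n. cmod (s - x k)) * (2 * r)) \<le>
      cmod a * ((r - 1) * (2 ^ n * (\<Prod>k<n. cmod (x k))))"
    by (intro mult_left_mono) (auto simp: s(2) r_def prod.distrib)
  moreover have "1 * (2 * r) \<le> cmod a * (\<Prod>k<n. cmod (s - x k)) * (2 * r)"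
    using ge r by (intro mult_right_mono) auto
  moreover have "(2 :: real) ^ n = 2 * 2 ^ (n - 1)"
    using i by (cases n) auto
  \<comment> \<open>The factor 2 at the chosen root cancels, which turns \<open>2 ^ n\<close> into
    \<open>2 ^ (n - 1)\<close>. The remaining \<open>r\<close> on the left exceeds the required
    1.\<close>
  ultimately have "r \<le> (r - 1) * (2 ^ (n - 1) * (cmod a * (\<Prod>k<n. cmod (x k))))"
    by (simp add: mult_ac)
  then show ?thesis
    using r by (simp add: r_def field_simps)
qed

lemma expansive_conjugate_roots_bound:
  fixes x :: "nat \<Rightarrow> complex"
  assumes big: "\<And>k. k < n \<Longrightarrow> 1 < cmod (x k)"
    and ij: "j < i" "i < n" and cnj: "x j = cnj (x i)"
    and ge: "1 \<le> cmod a ^ (n - 1) * (\<Prod>k<n. \<Prod>l<k. cmod (1 - x k * x l))"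
  shows "1 / (cmod (x i) - 1) \<le> 2 ^ (n choose 2) * (cmod a * (\<Prod>k<n. cmod (x k))) ^ (n - 1)"
proof -
  define r where "r = cmod (x i)"
  define R where "R = (\<Prod>k<n. cmod (x k))"
  define K where "K = 2 ^ (n choose 2) * (cmod a * R) ^ (n - 1)"
  have r: "r > 1" using big[OF ij(2)] by (simp add: r_def)
  have R: "R > 0" unfolding R_def by (rule prod_pos) (use big in fastforce)
  define S where "S = Sigma {..<n} (\<lambda>k. {..<k})"
  define w where "w = (\<lambda>(k, l). cmod (1 - x k * x l))"
  define g where "g = (\<lambda>(k, l). 2 * cmod (x k) * cmod (x l))"
  have "prod w S * g (i, j) \<le> w (i, j) * prod g S"
  proof (rule prod_mult_le_replace_factor)
    fix q assume "q \<in> S"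
    then obtain k l where q: "q = (k, l)" "k < n" "l < n" by (auto simp: S_def)
    have "1 \<le> cmod (x k) * cmod (x l)"
      using big[OF q(2)] big[OF q(3)] by (metis less_1_mult less_imp_le)
    then show "0 \<le> w q \<and> w q \<le> g q"
      using norm_triangle_ineq4[of 1 "x k * x l"] by (simp add: w_def g_def q norm_mult)
  qed (use ij in \<open>auto simp: S_def\<close>)
  moreover have "prod w S = (\<Prod>k<n. \<Prod>l<k. cmod (1 - x k * x l))"
    unfolding w_def S_def by (subst prod.Sigma) auto
  moreover have "prod g S = 2 ^ (n choose 2) * R ^ (n - 1)"
  proof -
    have "prod g S = (\<Prod>k<n. \<Prod>l<k. 2 * cmod (x k) * cmod (x l))"
      unfolding g_def S_def by (subst prod.Sigma) auto
    then have "prod g S * R = 2 ^ (n choose 2) * R ^ n"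
      using prod_pairs[of 2 "\<lambda>k. cmod (x k)" n] by (simp add: R_def)
    also have "R ^ n = R ^ (n - 1) * R"
      using ij by (cases n) auto
    finally show ?thesis using R by simp
  qed
  moreover have "g (i, j) = 2 * r\<^sup>2"
    by (simp add: g_def cnj r_def power2_eq_square)
  moreover have "w (i, j) = r\<^sup>2 - 1"
  proof -
    have "w (i, j) = cmod (of_real (1 - r\<^sup>2))"
      by (simp add: w_def cnj r_def flip: complex_norm_square)
    also have "\<dots> = r\<^sup>2 - 1"
      unfolding norm_of_real using r by (simp add: one_le_power)
    finally show ?thesis .
  qed
  ultimately have "(\<Prod>k<n. \<Prod>l<k. cmod (1 - x k * x l)) * (2 * r\<^sup>2) \<le>
      (r\<^sup>2 - 1) * (2 ^ (n choose 2) * R ^ (n - 1))"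
    by simp
  then have "cmod a ^ (n - 1) * ((\<Prod>k<n. \<Prod>l<k. cmod (1 - x k * x l)) * (2 * r\<^sup>2)) \<le>
      cmod a ^ (n - 1) * ((r\<^sup>2 - 1) * (2 ^ (n choose 2) * R ^ (n - 1)))"
    by (rule mult_left_mono) simp
  moreover have "1 * (2 * r\<^sup>2) \<le>
      cmod a ^ (n - 1) * (\<Prod>k<n. \<Prod>l<k. cmod (1 - x k * x l)) * (2 * r\<^sup>2)"
    using ge by (intro mult_right_mono) auto
  ultimately have "2 * r\<^sup>2 \<le> (r\<^sup>2 - 1) * K"
    by (simp add: K_def power_mult_distrib mult_ac)
  \<comment> \<open>The two sides of the first inequality differ by the square of
    \<open>r - 1\<close>; afterwards \<open>2 * r\<close> can be cancelled.\<close>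
  also have "\<dots> \<le> ((r - 1) * (2 * r)) * K"
  proof (rule mult_right_mono)
    show "r\<^sup>2 - 1 \<le> (r - 1) * (2 * r)"
      using zero_le_power2[of "r - 1"] by (simp add: power2_eq_square algebra_simps)
    show "0 \<le> K" using R by (simp add: K_def)
  qed
  finally have "(2 * r) * r \<le> (2 * r) * ((r - 1) * K)"
    by (simp add: power2_eq_square mult_ac)
  then have "r \<le> (r - 1) * K"
    using r by simp
  then have "1 \<le> (r - 1) * K"
    using r by linarith
  then show ?thesis
    using r unfolding K_def R_def r_def by (simp add: field_simps)
qed

section \<open>Integrality and conclusion\<close>

text \<open>This makes the determinant over the complex numbers an integer, since determinants
  commute with ring homomorphisms.\<close>

lemma jury_mat_map_of_int:
  "jury_mat m (map_poly (of_int :: int \<Rightarrow> 'a :: {comm_ring_1, ring_char_0}) f) = map_mat of_int (jury_mat m f)"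
  by (rule eq_matI) (auto simp: jury_mat_def coeff_map_poly)

theorem theorem4p3:
  fixes f :: "int poly" and n :: nat and \<alpha> :: complex
  assumes "degree f = n" and "n \<ge> 1"
    and "expansive (map_poly of_int f)"
    and "poly (map_poly of_int f) \<alpha> = 0"
  shows "1 / (cmod \<alpha> - 1) \<le>
    (if \<alpha> \<in> \<real> then 2 ^ (n - 1) * real_of_int \<bar>coeff f 0\<bar>
     else 2 ^ (n choose 2) * real_of_int \<bar>coeff f 0\<bar> ^ (n - 1) + 1)"
proof -
  define p :: "complex poly" where "p = map_poly of_int f"
  define a where "a = lead_coeff p"
  have deg: "degree p = n"
    using assms(1) by (simp add: p_def degree_map_poly)
  then have "p \<noteq> 0" using assms(2) by auto
  then have "a \<noteq> 0" by (simp add: a_def)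
  obtain x where px: "p = Polynomial.smult a (\<Prod>l<n. [:- x l, 1:])"
    using complex_poly_split[OF \<open>p \<noteq> 0\<close>] unfolding a_def deg by blast
  have ev: "poly p z = a * (\<Prod>l<n. z - x l)" for z
    by (subst px) (simp add: poly_prod)
  have exp: "1 < cmod z" if "poly p z = 0" for z
    using assms(3) that by (auto simp: expansive_def p_def)
  have big: "1 < cmod (x k)" if "k < n" for k
    by (rule exp) (use that in \<open>auto simp: ev\<close>)
  have root: "\<exists>k<n. x k = z" if "poly p z = 0" for z
    using that \<open>a \<noteq> 0\<close> by (auto simp: ev)
  have a0: "real_of_int \<bar>coeff f 0\<bar> = cmod a * (\<Prod>k<n. cmod (x k))"
  proof -
    have "complex_of_int (coeff f 0) = poly p 0"
      by (simp add: p_def poly_0_coeff_0 coeff_map_poly)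
    then have "cmod (complex_of_int (coeff f 0)) = cmod a * (\<Prod>k<n. cmod (x k))"
      by (simp add: ev norm_mult prod_norm[symmetric])
    then show ?thesis by simp
  qed
  obtain i where i: "i < n" "x i = \<alpha>"
    using root assms(4) unfolding p_def by blast
  show ?thesis
  proof (cases "\<alpha> \<in> \<real>")
    case True
    then obtain t where t: "\<alpha> = of_real t" by (auto elim: Reals_cases)
    have t1: "1 < \<bar>t\<bar>" using big[OF i(1)] by (simp add: i t)
    define s :: int where "s = (if t > 0 then 1 else - 1)"
    have s: "cmod (of_int s) = 1" "cmod (of_int s - x i) = cmod (x i) - 1"
    proof -
      show "cmod (of_int s) = 1" by (simp add: s_def)
      have "of_int s - x i = of_real (of_int s - t)" by (simp add: i t)
      then have "cmod (of_int s - x i) = \<bar>of_int s - t\<bar>" by (metis norm_of_real)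
      then show "cmod (of_int s - x i) = cmod (x i) - 1"
        using t1 by (auto simp: i t s_def)
    qed
    have val: "poly p (of_int s) = of_int (poly f s)"
      by (simp add: p_def poly_altdef degree_map_poly coeff_map_poly)
    \<comment> \<open>Expansivity excludes roots on the unit circle, so the integer
      \<open>poly f s\<close> has modulus at least 1.\<close>
    have "poly p (of_int s) \<noteq> 0"
      using exp[of "of_int s"] s(1) by auto
    then have "1 \<le> \<bar>poly f s\<bar>" unfolding val by simp
    then have "1 \<le> cmod (poly p (of_int s))" unfolding val by simp
    then have "1 \<le> cmod a * (\<Prod>k<n. cmod (of_int s - x k))"
      by (simp add: ev norm_mult prod_norm[symmetric])
    from expansive_real_root_bound[OF big i(1) s this] show ?thesis
      using True by (simp only: a0 i if_True)
  next
    case False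
    have "poly p (cnj \<alpha>) = cnj (poly p \<alpha>)"
      by (simp add: p_def poly_altdef coeff_map_poly)
    then have "poly p (cnj \<alpha>) = 0" using assms(4) by (simp add: p_def)
    then obtain j where j: "j < n" "x j = cnj \<alpha>" using root by blast
    have "i \<noteq> j" using False i j by (metis Reals_cnj_iff)
    obtain m where m: "n = Suc m" using assms(2) by (cases n) auto
    have "cmod (det (jury_mat m p)) = cmod a ^ m * (\<Prod>k<Suc m. \<Prod>l<k. cmod (1 - x k * x l))"
      by (rule norm_det_jury_mat) (use big px m in auto)
    also have "det (jury_mat m p) = of_int (det (jury_mat m f))"
      unfolding p_def jury_mat_map_of_int by (rule of_int_hom.hom_det)
    finally have eq: "real_of_int \<bar>det (jury_mat m f)\<bar> =
        cmod a ^ (n - 1) * (\<Prod>k<n. \<Prod>l<k. cmod (1 - x k * x l))"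
      by (simp add: m)
    have "1 - x k * x l \<noteq> 0" if "k < n" "l < n" for k l
    proof
      assume "1 - x k * x l = 0"
      then have "cmod (x k) * cmod (x l) = 1" by (metis eq_iff_diff_eq_0 norm_mult norm_one)
      then show False
        using less_1_mult[OF big[OF that(1)] big[OF that(2)]] by simp
    qed
    then have "0 < cmod a ^ (n - 1) * (\<Prod>k<n. \<Prod>l<k. cmod (1 - x k * x l))"
      using \<open>a \<noteq> 0\<close> by (intro mult_pos_pos prod_pos ballI) auto
    then have "0 < \<bar>det (jury_mat m f)\<bar>" unfolding eq[symmetric] by (simp only: of_int_0_less_iff)
    then have ge: "1 \<le> cmod a ^ (n - 1) * (\<Prod>k<n. \<Prod>l<k. cmod (1 - x k * x l))"
      unfolding eq[symmetric] by linarith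
    have "1 / (cmod \<alpha> - 1) \<le> 2 ^ (n choose 2) * real_of_int \<bar>coeff f 0\<bar> ^ (n - 1)"
    \<comment> \<open>The enumeration may list either conjugate first. Both have the same modulus,
      so the bound for the one with the larger index serves for \<alpha>.\<close>
    proof (cases "j < i")
      case True
      from expansive_conjugate_roots_bound[OF big this i(1) _ ge] show ?thesis
        unfolding a0 by (simp add: i j)
    next
      case False
      then have "i < j" using \<open>i \<noteq> j\<close> by simp
      from expansive_conjugate_roots_bound[OF big this j(1) _ ge] show ?thesis
        unfolding a0 by (simp add: i j)
    qed
    then show ?thesis using False by simp
  qed
qed

end
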